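(* Let $\ell\ge3$ and $0\le i<\ell$. The $i$-signature (and hence the reduced $i$-signature) of an $\ell$-regular partition $\lambda$ (a node of $B(\Lambda_0)$) can be determined by reading from its leftmost ladder to its rightmost ladder, bottom to top on each ladder; that is, the word of $+$'s and $-$'s in the addable and removable $i$-boxes of $\lambda$ read in this order equals the $i$-signature of $\lambda$.
   Context: A partition is $\ell$-regular if it does not have $\ell$ or more equal nonzero parts. The position $(a,b)$ (row $a$, rows numbered downward; column $b$) has residue $b-a\bmod\ell$. A box of $\lambda$ of residue $i$ whose removal leaves a partition is a removable $i$-box (marked $-$); a position of residue $i$ not in $\lambda$ whose addition gives a partition is an addable $i$-box (marked $+$). The (classical) $i$-signature of $\lambda$ is the word of these $+$'s and $-$'s read from bottom left to top right (i.e. from the bottom row to the top row); the reduced $i$-signature is obtained by repeatedly deleting adjacent pairs $-+$. The ladder of $(a,b)$ is the set of positions $(c,d)$, $c,d\ge1$, with $c-a=(\ell-1)(b-d)$. Ladders are ordered left to right, i.e. by increasing value of $a+(\ell-1)(b-1)$. *)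

theory Defs
  imports Main
begin

definition is_partition :: "nat list \<Rightarrow> bool" where
  "is_partition lam \<longleftrightarrow> sorted_wrt (\<ge>) lam \<and> 0 \<notin> set lam"

definition regular_partition :: "nat \<Rightarrow> nat list \<Rightarrow> bool" where
  "regular_partition l lam \<longleftrightarrow> is_partition lam \<and> (\<forall>k>0. count_list lam k < l)"

(* Positions are pairs (row, column), both counted from 1. *)
definition diagram :: "nat list \<Rightarrow> (nat \<times> nat) set" where
  "diagram lam = {(a, b). 1 \<le> a \<and> a \<le> length lam \<and> 1 \<le> b \<and> b \<le> lam ! (a - 1)}"

definition residue :: "nat \<Rightarrow> nat \<times> nat \<Rightarrow> int" where
  "residue l = (\<lambda>(a, b). (int b - int a) mod int l)"

definition removable :: "nat list \<Rightarrow> nat \<times> nat \<Rightarrow> bool" where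
  "removable lam x \<longleftrightarrow>
     x \<in> diagram lam \<and> (\<exists>mu. is_partition mu \<and> diagram mu = diagram lam - {x})"

definition addable :: "nat list \<Rightarrow> nat \<times> nat \<Rightarrow> bool" where
  "addable lam x \<longleftrightarrow>
     x \<notin> diagram lam \<and> (\<exists>mu. is_partition mu \<and> diagram mu = insert x (diagram lam))"

definition signature_boxes :: "nat \<Rightarrow> nat \<Rightarrow> nat list \<Rightarrow> (nat \<times> nat) set" where
  "signature_boxes l i lam =
     {x. residue l x = int i \<and> (addable lam x \<or> removable lam x)}"

lemma finite_diagram: "finite (diagram lam)"
proof (rule finite_subset)
  show "diagram lam \<subseteq> {..length lam} \<times> {..Max (set lam \<union> {0})}"
    by (auto simp: diagram_def intro!: order_trans[OF _ Max_ge])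
qed simp

lemma finite_signature_boxes: "finite (signature_boxes l i lam)"
proof (rule finite_subset)
  define R where "R = insert 1 (Suc ` fst ` diagram lam)"
  define C where "C = insert 1 (Suc ` snd ` diagram lam)"
  have "x \<in> R \<times> C" if "addable lam x" for x
  proof -
    obtain a b where x: "x = (a, b)" by (cases x)
    from that obtain mu where mu: "is_partition mu" "diagram mu = insert (a, b) (diagram lam)"
      unfolding addable_def x by blast
    then have ab: "(a, b) \<in> diagram mu" by blast
    have "a \<in> R"
    proof (cases "a = 1")
      case False
      with ab have "mu ! (a - 1) \<le> mu ! (a - 2)"
        using mu(1) sorted_wrt_nth_less[of "(\<ge>)" mu "a - 2" "a - 1"]
        by (auto simp: diagram_def is_partition_def)
      with ab False have "(a - 1, b) \<in> diagram mu"
        by (auto simp: diagram_def numeral_2_eq_2)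
      moreover have "a = Suc (a - 1)" "a - 1 \<noteq> a" using ab by (auto simp: diagram_def)
      ultimately have "(a - 1, b) \<in> diagram lam" using mu(2) by auto
      with \<open>a = Suc (a - 1)\<close> show ?thesis unfolding R_def by (force simp: image_iff)
    qed (simp add: R_def)
    moreover have "b \<in> C"
    proof (cases "b = 1")
      case False
      with ab have "(a, b - 1) \<in> diagram mu" by (auto simp: diagram_def)
      moreover have "b = Suc (b - 1)" "b - 1 \<noteq> b" using ab by (auto simp: diagram_def)
      ultimately have "(a, b - 1) \<in> diagram lam" using mu(2) by auto
      with \<open>b = Suc (b - 1)\<close> show ?thesis unfolding C_def by (force simp: image_iff)
    qed (simp add: C_def)
    ultimately show ?thesis by (simp add: x)
  qed
  then show "signature_boxes l i lam \<subseteq> R \<times> C \<union> diagram lam"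
    by (auto simp: signature_boxes_def removable_def)
  show "finite (R \<times> C \<union> diagram lam)"
    by (simp add: R_def C_def finite_diagram)
qed

datatype sign = Plus | Minus

definition box_sign :: "nat list \<Rightarrow> nat \<times> nat \<Rightarrow> sign" where
  "box_sign lam x = (if addable lam x then Plus else Minus)"

(* The elements of a finite set of positions from the bottom row to the top row.  The
   left-to-right convention inside a row is immaterial below: a row contains at most one
   element of signature_boxes (for l > 1), and a ladder meets a row at most once (for l > 1). *)
definition bottom_to_top :: "(nat \<times> nat) set \<Rightarrow> (nat \<times> nat) list" where
  "bottom_to_top S =
     concat (map (\<lambda>a. map (Pair a) (sorted_list_of_set {b. (a, b) \<in> S}))
                 (rev (sorted_list_of_set (fst ` S))))"

definition i_signature :: "nat \<Rightarrow> nat \<Rightarrow> nat list \<Rightarrow> sign list" where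
  "i_signature l i lam = map (box_sign lam) (bottom_to_top (signature_boxes l i lam))"

definition ladder :: "nat \<Rightarrow> nat \<times> nat \<Rightarrow> (nat \<times> nat) set" where
  "ladder l = (\<lambda>(a, b). {(c, d). c \<ge> 1 \<and> d \<ge> 1 \<and>
      int c - int a = (int l - 1) * (int b - int d)})"

definition ladder_value :: "nat \<Rightarrow> nat \<times> nat \<Rightarrow> nat" where
  "ladder_value l = (\<lambda>(a, b). a + (l - 1) * (b - 1))"

lemma ladder_eq_first_column:
  assumes "l \<ge> 1" "b \<ge> 1"
  shows "ladder l (a, b) = ladder l (ladder_value l (a, b), 1)"
proof -
  have "int (ladder_value l (a, b)) = int a + (int l - 1) * (int b - 1)"
    using assms by (simp add: ladder_value_def of_nat_diff)
  then show ?thesis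
    by (auto simp: ladder_def algebra_simps)
qed

(* Only the ladders meeting S are visited, from left to right.  By ladder_eq_first_column
   the ladder of value n is the ladder of (n, 1). *)
definition ladder_reading :: "nat \<Rightarrow> (nat \<times> nat) set \<Rightarrow> (nat \<times> nat) list" where
  "ladder_reading l S =
     concat (map (\<lambda>n. bottom_to_top (S \<inter> ladder l (n, 1)))
                 (sorted_list_of_set (ladder_value l ` S)))"

definition ladder_signature :: "nat \<Rightarrow> nat \<Rightarrow> nat list \<Rightarrow> sign list" where
  "ladder_signature l i lam = map (box_sign lam) (ladder_reading l (signature_boxes l i lam))"

inductive cancel :: "sign list \<Rightarrow> sign list \<Rightarrow> bool" where
  "cancel (u @ [Minus, Plus] @ v) (u @ v)"

definition reduced_form :: "sign list \<Rightarrow> sign list \<Rightarrow> bool" where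
  "reduced_form w r \<longleftrightarrow> cancel\<^sup>*\<^sup>* w r \<and> \<not> (\<exists>s. cancel r s)"

definition reduced_word :: "sign list \<Rightarrow> sign list" where
  "reduced_word w = (THE r. reduced_form w r)"

definition reduced_i_signature :: "nat \<Rightarrow> nat \<Rightarrow> nat list \<Rightarrow> sign list" where
  "reduced_i_signature l i lam = reduced_word (i_signature l i lam)"

(* The order of the deletions does not matter, so reduced_word is well defined. *)
lemma reduced_form_ex1: "\<exists>!r. reduced_form w r"
proof -
  define push where "push c xs = (case xs of Plus # ys \<Rightarrow> if c = Minus then ys else c # xs | _ \<Rightarrow> c # xs)"
    for c and xs :: "sign list"
  have nf_cancel: "foldr push w [] = foldr push w' []" if "cancel w w'" for w w'
    using that by cases (simp add: push_def split: list.split sign.split)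
  have nf_cancels: "foldr push w [] = foldr push w' []" if "cancel\<^sup>*\<^sup>* w w'" for w w'
    using that by induction (auto dest: nf_cancel)
  have nf_id: "foldr push w [] = w" if "\<not> (\<exists>s. cancel w s)" for w
    using that
  proof (induction w)
    case (Cons c w)
    have "\<not> (\<exists>s. cancel w s)"
    proof
      assume "\<exists>s. cancel w s"
      then obtain s where "cancel w s" ..
      then have "\<exists>s. cancel (c # w) s"
      proof cases
        case (1 u v)
        then show ?thesis using cancel.intros[of "c # u" v] by auto
      qed
      with Cons.prems show False by blast
    qed
    then have w: "foldr push w [] = w" by (rule Cons.IH)
    have "\<not> (c = Minus \<and> w = Plus # v)" for v
      using Cons.prems cancel.intros[of "[]" v] by auto
    then have "push c w = c # w" by (auto simp: push_def split: list.split sign.split)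
    then show ?case using w by simp
  qed simp
  have "\<exists>r. reduced_form w r"
  proof (induction "length w" arbitrary: w rule: less_induct)
    case less
    show ?case
    proof (cases "\<exists>s. cancel w s")
      case True
      then obtain s where s: "cancel w s" ..
      then have "length s < length w" by cases simp
      with less obtain r where "reduced_form s r" by blast
      with s show ?thesis
        unfolding reduced_form_def by (meson converse_rtranclp_into_rtranclp)
    next
      case False
      then show ?thesis unfolding reduced_form_def by blast
    qed
  qed
  moreover have "r = foldr push w []" if "reduced_form w r" for r
    using that nf_id nf_cancels unfolding reduced_form_def by metis
  ultimately show ?thesis by metis
qed

end

theory Submission
  imports Defs
begin

text \<open>
  It suffices that on the boxes in question the ladder value does not decrease when passing to a
  higher row. Let \<open>(a, b)\<close> lie below \<open>(c, d)\<close>. The rows strictly between them all have length in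
  \<open>{b..<d}\<close>, and so does row \<open>a\<close> if \<open>(a, b)\<close> is removable and row \<open>c\<close> if \<open>(c, d)\<close> is addable.
  By regularity there are at most \<open>(l - 1) * (d - b)\<close> such rows, which gives
  \<open>a - c \<le> (l - 1) * (d - b)\<close> except when \<open>(c, d)\<close> is removable and \<open>(a, b)\<close> is addable; then the
  bound may fail by one, but in that case the two residues would differ.
\<close>

section \<open>Row lengths and the shape of addable and removable boxes\<close>

text \<open>The value 0 below the diagram lets an addable box in a new row and a removable box in
  the last row be treated like all others. Index 0 also gets 0, so monotonicity starts at row
  1.\<close>

definition row_length :: "nat list \<Rightarrow> nat \<Rightarrow> nat" where
  "row_length lam a = (if 1 \<le> a \<and> a \<le> length lam then lam ! (a - 1) else 0)"

lemma mem_diagram_iff: "(a, b) \<in> diagram lam \<longleftrightarrow> 1 \<le> a \<and> 1 \<le> b \<and> b \<le> row_length lam a"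
  by (auto simp: diagram_def row_length_def)

lemma row_length_antimono:
  assumes "is_partition lam" "1 \<le> a" "a \<le> a'"
  shows "row_length lam a' \<le> row_length lam a"
  using assms sorted_wrt_nth_less[of "(\<ge>)" lam "a - 1" "a' - 1"]
  by (cases "a = a'") (auto simp: row_length_def is_partition_def)

lemma removableD:
  assumes "removable lam (a, b)"
  shows "1 \<le> a" "1 \<le> b" "row_length lam a = b" "row_length lam (Suc a) < b"
proof -
  from assms obtain mu where mu: "is_partition mu" "diagram mu = diagram lam - {(a, b)}"
    and ab: "(a, b) \<in> diagram lam"
    by (auto simp: removable_def)
  show a: "1 \<le> a" and b: "1 \<le> b" using ab by (auto simp: mem_diagram_iff)
  have n: "(a, b) \<notin> diagram mu" using mu(2) by blast
  then have m: "row_length mu a < b" using a b by (simp add: mem_diagram_iff)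
  \<comment> \<open>\<open>mu\<close> and \<open>lam\<close> differ only at \<open>(a, b)\<close>,
    so row \<open>a\<close> of \<open>lam\<close> cannot extend beyond column
    \<open>b\<close>.\<close>
  have "(a, Suc b) \<notin> diagram mu" using m by (simp add: mem_diagram_iff)
  then have "(a, Suc b) \<notin> diagram lam" using mu(2) by simp
  then show "row_length lam a = b" using ab by (simp add: mem_diagram_iff)
  have "(Suc a, b) \<notin> diagram mu"
    using m row_length_antimono[OF mu(1) a, of "Suc a"] by (simp add: mem_diagram_iff)
  then have "(Suc a, b) \<notin> diagram lam" using mu(2) by simp
  then show "row_length lam (Suc a) < b" using b by (simp add: mem_diagram_iff)
qed

lemma addableD:
  assumes "addable lam (a, b)"
  shows "1 \<le> a" "1 \<le> b" "Suc (row_length lam a) = b" "1 < a \<Longrightarrow> b \<le> row_length lam (a - 1)"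
proof -
  from assms obtain mu where mu: "is_partition mu" "diagram mu = insert (a, b) (diagram lam)"
    and n: "(a, b) \<notin> diagram lam"
    by (auto simp: addable_def)
  have ab: "(a, b) \<in> diagram mu" using mu(2) by blast
  show a: "1 \<le> a" and b: "1 \<le> b" using ab by (auto simp: mem_diagram_iff)
  have "b - 1 \<le> row_length lam a"
  proof (cases "b = 1")
    case False
    then have "(a, b - 1) \<in> diagram mu" using ab by (auto simp: mem_diagram_iff)
    then have "(a, b - 1) \<in> diagram lam" using mu(2) b by auto
    then show ?thesis by (simp add: mem_diagram_iff)
  qed simp
  then show "Suc (row_length lam a) = b" using n a b by (simp add: mem_diagram_iff)
  show "b \<le> row_length lam (a - 1)" if "1 < a"
  proof -
    have "1 \<le> a - 1" using that by simp
    then have "(a - 1, b) \<in> diagram mu"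
      using ab row_length_antimono[OF mu(1), of "a - 1" a] by (simp add: mem_diagram_iff)
    then have "(a - 1, b) \<in> diagram lam" using mu(2) a by auto
    then show ?thesis by (simp add: mem_diagram_iff)
  qed
qed

section \<open>Counting rows by regularity\<close>

text \<open>Row numbers are list indices shifted by one. For \<open>v = 0\<close> the set would be
  infinite, as every row below the diagram has length 0.\<close>

lemma card_rows_of_length:
  assumes "0 < v"
  shows "finite {r. row_length lam r = v}" "card {r. row_length lam r = v} = count_list lam v"
proof -
  have eq: "{r. row_length lam r = v} = Suc ` {j. j < length lam \<and> v = lam ! j}"
  proof (intro set_eqI iffI)
    fix r assume "r \<in> {r. row_length lam r = v}"
    with assms have "r = Suc (r - 1)" "r - 1 < length lam" "v = lam ! (r - 1)"
      by (auto simp: row_length_def split: if_splits)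
    then show "r \<in> Suc ` {j. j < length lam \<and> v = lam ! j}" by blast
  qed (auto simp: row_length_def)
  show "finite {r. row_length lam r = v}" unfolding eq by simp
  show "card {r. row_length lam r = v} = count_list lam v"
    unfolding eq by (simp add: card_image count_list_eq_length_filter length_filter_conv_card)
qed

text \<open>The rows are distributed over the \<open>d - b\<close> lengths in
  \<open>{b..<d}\<close>; these are positive, so regularity allows at most \<open>l - 1\<close> rows
  for each.\<close>

lemma card_rows_le:
  assumes "regular_partition l lam" "1 \<le> b"
    and "\<And>r. p \<le> r \<Longrightarrow> r < q \<Longrightarrow> b \<le> row_length lam r \<and> row_length lam r < d"
  shows "q - p \<le> (l - 1) * (d - b)"
proof -
  let ?R = "\<lambda>v. {r. row_length lam r = v}"
  have "q - p = card {p..<q}" by simp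
  also have "\<dots> \<le> card (\<Union>v\<in>{b..<d}. ?R v)"
    using assms(2,3) by (intro card_mono) (auto intro!: card_rows_of_length(1))
  also have "\<dots> \<le> (\<Sum>v\<in>{b..<d}. card (?R v))"
    by (rule card_UN_le) simp
  also have "\<dots> \<le> (\<Sum>v\<in>{b..<d}. l - 1)"
  proof (rule sum_mono)
    fix v assume "v \<in> {b..<d}"
    with assms(1,2) show "card (?R v) \<le> l - 1"
      by (subst card_rows_of_length(2)) (auto simp: regular_partition_def less_eq_Suc_le dest: spec[of _ v])
  qed
  finally show ?thesis by (simp add: mult.commute)
qed

section \<open>Residues and ladder values of signature boxes\<close>

lemma signature_box_pos:
  assumes "(a, b) \<in> signature_boxes l i lam"
  shows "1 \<le> a" "1 \<le> b"
  using assms by (auto simp: signature_boxes_def dest: addableD(1,2) removableD(1,2))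

lemma residue_eq_iff_dvd:
  "residue l (a, b) = residue l (c, d) \<longleftrightarrow> int l dvd (int b - int a) - (int d - int c)"
  by (simp add: residue_def mod_eq_dvd_iff)

lemma inj_on_fst_signature_boxes:
  assumes "2 \<le> l"
  shows "inj_on fst (signature_boxes l i lam)"
proof (rule inj_onI)
  fix x y assume xy: "x \<in> signature_boxes l i lam" "y \<in> signature_boxes l i lam" "fst x = fst y"
  obtain a b c where e: "x = (a, b)" "y = (a, c)" using xy(3) by (cases x; cases y) auto
  have "int l dvd (int b - int a) - (int c - int a)"
    unfolding residue_eq_iff_dvd[symmetric] using xy e by (simp add: signature_boxes_def)
  then have dvd: "int l dvd int b - int c" by simp
  \<comment> \<open>A removable box ends its row and an addable one comes right after the end, so
    two such boxes of one row are at most one column apart; divisibility by \<open>l \<ge> 2\<close>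
    then makes them coincide.\<close>
  have "b = c \<or> b = Suc c \<or> c = Suc b"
    using xy e by (auto simp: signature_boxes_def dest!: addableD(3) removableD(3))
  then show "x = y" using dvd assms e by (auto dest: zdvd_imp_le)
qed

lemma ladder_value_mono_signature_boxes:
  assumes "2 \<le> l" and reg: "regular_partition l lam"
    and ab: "(a, b) \<in> signature_boxes l i lam" and cd: "(c, d) \<in> signature_boxes l i lam"
    and "c < a"
  shows "ladder_value l (a, b) \<le> ladder_value l (c, d)"
proof -
  have part: "is_partition lam" using reg by (simp add: regular_partition_def)
  note pos = signature_box_pos[OF ab] signature_box_pos[OF cd]
  note anti = row_length_antimono[OF part]
  \<comment> \<open>Rows above \<open>(a, b)\<close> have length at least \<open>b\<close>, and so
    has row \<open>a\<close> in the removable case; rows below \<open>(c, d)\<close> are shorter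
    than \<open>d\<close>, and so is row \<open>c\<close> in the addable case.\<close>
  have lower_add: "b \<le> row_length lam r" if "addable lam (a, b)" "1 \<le> r" "r < a" for r
    using addableD(4)[OF that(1)] anti[of r "a - 1"] that by linarith
  have lower_rem: "b \<le> row_length lam r" if "removable lam (a, b)" "1 \<le> r" "r < Suc a" for r
    using removableD(3)[OF that(1)] anti[of r a] that by linarith
  have upper_add: "row_length lam r < d" if "addable lam (c, d)" "c \<le> r" for r
    using addableD(3)[OF that(1)] anti[of c r] that pos by linarith
  have upper_rem: "row_length lam r < d" if "removable lam (c, d)" "Suc c \<le> r" for r
    using removableD(4)[OF that(1)] anti[of "Suc c" r] that by linarith
  \<comment> \<open>The ladder values differ by \<open>(l - 1) * (d - b) - (a - c)\<close>;
    \<open>b \<le> d\<close> keeps truncated subtraction exact.\<close>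
  have "b \<le> d \<and> a - c \<le> (l - 1) * (d - b)"
  proof (cases "addable lam (c, d) \<or> removable lam (a, b)")
    case True
    have "a - c \<le> (l - 1) * (d - b)"
    proof (cases "addable lam (c, d)")
      case up: True
      show ?thesis
        using ab pos lower_add lower_rem upper_add[OF up]
        by (intro card_rows_le[OF reg]) (auto simp: signature_boxes_def)
    next
      case False
      then have low: "removable lam (a, b)" and up: "removable lam (c, d)"
        using True cd by (auto simp: signature_boxes_def)
      \<comment> \<open>For two removable boxes the window moves down by one row, to
        \<open>c + 1, ..., a\<close>, and still has \<open>a - c\<close> rows.\<close>
      have "Suc a - Suc c \<le> (l - 1) * (d - b)"
        using pos lower_rem[OF low] upper_rem[OF up]
        by (intro card_rows_le[OF reg]) auto
      then show ?thesis by simp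
    qed
    moreover from this have "d - b \<noteq> 0" using \<open>c < a\<close> by (intro notI) simp
    ultimately show ?thesis by simp
  next
    case False
    then have low: "addable lam (a, b)" and up: "removable lam (c, d)"
      using ab cd by (auto simp: signature_boxes_def)
    have le: "b \<le> d"
      using lower_add[OF low, of c] removableD(3)[OF up] pos \<open>c < a\<close> by simp
    have bound: "a - Suc c \<le> (l - 1) * (d - b)"
      using pos lower_add[OF low] upper_rem[OF up] by (intro card_rows_le[OF reg]) auto
    \<comment> \<open>Only the rows strictly between are available, one too few, so equality has to
      be excluded: it would make the values of column minus row differ by \<open>-1\<close> modulo
      \<open>l\<close>, against the equal residues.\<close>
    have "a - Suc c \<noteq> (l - 1) * (d - b)"
    proof
      assume "a - Suc c = (l - 1) * (d - b)"
      then have "int (a - Suc c) = int ((l - 1) * (d - b))" by (rule arg_cong)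
      then have "int a = int c + 1 + (int l - 1) * (int d - int b)"
        using \<open>c < a\<close> le \<open>2 \<le> l\<close> by (simp add: of_nat_diff)
      then have "(int b - int a) - (int d - int c) = int l * (int b - int d) - 1"
        by (simp add: algebra_simps)
      moreover have "int l dvd (int b - int a) - (int d - int c)"
        unfolding residue_eq_iff_dvd[symmetric] using ab cd by (simp add: signature_boxes_def)
      ultimately have "int l dvd int l * (int b - int d) - 1" by simp
      then have "int l dvd 1" by (metis dvd_diff_right_iff dvd_triv_left)
      then show False using \<open>2 \<le> l\<close> by simp
    qed
    then show ?thesis using le bound by linarith
  qed
  moreover have "(l - 1) * (d - 1) = (l - 1) * (b - 1) + (l - 1) * (d - b)" if "b \<le> d"
    using that pos by (simp add: distrib_left[symmetric])
  ultimately show ?thesis using \<open>c < a\<close> unfolding ladder_value_def prod.case by linarith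
qed

section \<open>Readings as sorted lists of boxes\<close>

lemma set_bottom_to_top:
  assumes "finite S"
  shows "set (bottom_to_top S) = S"
proof -
  have "finite {b. (a, b) \<in> S}" for a
    by (rule finite_subset[of _ "snd ` S"]) (use assms in force)+
  then show ?thesis using assms by (force simp: bottom_to_top_def)
qed

text \<open>With one box per row every inner list is a singleton.\<close>

lemma map_fst_bottom_to_top:
  assumes "finite S" "inj_on fst S"
  shows "map fst (bottom_to_top S) = rev (sorted_list_of_set (fst ` S))"
proof -
  have 1: "map fst (map (Pair a) (sorted_list_of_set {b. (a, b) \<in> S})) = [a]" if "a \<in> fst ` S" for a
  proof -
    from that obtain b where b: "(a, b) \<in> S" by auto
    then have "{b. (a, b) \<in> S} = {b}" using inj_onD[OF assms(2)] by fastforce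
    then show ?thesis by simp
  qed
  have "map fst (bottom_to_top S) =
      concat (map (\<lambda>a. map fst (map (Pair a) (sorted_list_of_set {b. (a, b) \<in> S})))
        (rev (sorted_list_of_set (fst ` S))))"
    by (simp add: bottom_to_top_def map_concat comp_def)
  also have "\<dots> = concat (map (\<lambda>a. [a]) (rev (sorted_list_of_set (fst ` S))))"
    using assms(1) 1 by (intro arg_cong[of _ _ concat] map_cong refl) simp
  finally show ?thesis by simp
qed

lemma sorted_wrt_bottom_to_top:
  assumes "finite S" "inj_on fst S"
  shows "sorted_wrt (\<lambda>x y. fst y < fst x) (bottom_to_top S)"
proof -
  have "sorted_wrt (\<lambda>a b. b < a) (map fst (bottom_to_top S))"
    using assms by (simp add: map_fst_bottom_to_top sorted_wrt_rev)
  then show ?thesis by (simp add: sorted_wrt_map)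
qed

lemma mem_first_column_ladder_iff:
  assumes "1 \<le> l" "1 \<le> a" "1 \<le> b"
  shows "(a, b) \<in> ladder l (n, 1) \<longleftrightarrow> ladder_value l (a, b) = n"
proof -
  have "int (ladder_value l (a, b)) = int a + (int l - 1) * (int b - 1)"
    using assms by (simp add: ladder_value_def of_nat_diff)
  then have "ladder_value l (a, b) = n \<longleftrightarrow> int a + (int l - 1) * (int b - 1) = int n"
    by (metis of_nat_eq_iff)
  then show ?thesis using assms by (auto simp: ladder_def algebra_simps)
qed

lemma sorted_wrt_concat_map:
  assumes "sorted_wrt Q ns" "\<And>n. n \<in> set ns \<Longrightarrow> sorted_wrt P (f n)"
    and "\<And>m n x y. m \<in> set ns \<Longrightarrow> n \<in> set ns \<Longrightarrow> Q m n \<Longrightarrow> x \<in> set (f m) \<Longrightarrow> y \<in> set (f n) \<Longrightarrow> P x y"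
  shows "sorted_wrt P (concat (map f ns))"
  using assms
proof (induction ns)
  case (Cons a ns)
  have "sorted_wrt P (concat (map f ns))"
    using Cons.prems(1,2) by (intro Cons.IH) (auto intro: Cons.prems(3))
  moreover have "P x y" if "x \<in> set (f a)" "y \<in> set (concat (map f ns))" for x y
  proof -
    from that(2) obtain n where "n \<in> set ns" "y \<in> set (f n)" by auto
    with that(1) Cons.prems(1) Cons.prems(3)[of a n x y] show ?thesis by simp
  qed
  ultimately show ?case using Cons.prems(2) by (auto simp: sorted_wrt_append)
qed simp

text \<open>The reversed row lists are strictly increasing with the same set, hence equal;
  injectivity of \<open>fst\<close> lifts this to the pairs.\<close>

lemma sorted_wrt_fst_unique:
  fixes xs ys :: "('a :: linorder \<times> 'b) list"
  assumes "sorted_wrt (\<lambda>x y. fst y < fst x) xs" "sorted_wrt (\<lambda>x y. fst y < fst x) ys"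
    and "set xs = set ys" "inj_on fst (set xs)"
  shows "xs = ys"
proof -
  have "rev (map fst xs) = rev (map fst ys)"
    using assms by (intro strict_sorted_equal) (simp_all add: sorted_wrt_rev sorted_wrt_map)
  then show ?thesis using assms by (auto intro: map_inj_on)
qed

text \<open>Both readings list the same set with strictly decreasing rows, so they coincide by
  \<open>sorted_wrt_fst_unique\<close>.\<close>

lemma ladder_reading_eq_bottom_to_top:
  assumes "1 \<le> l" and fin: "finite S" and inj: "inj_on fst S"
    and pos: "\<And>a b. (a, b) \<in> S \<Longrightarrow> 1 \<le> a \<and> 1 \<le> b"
    and mono: "\<And>x y. x \<in> S \<Longrightarrow> y \<in> S \<Longrightarrow> fst y < fst x \<Longrightarrow> ladder_value l x \<le> ladder_value l y"
  shows "ladder_reading l S = bottom_to_top S"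
proof -
  have lad: "S \<inter> ladder l (n, 1) = {x \<in> S. ladder_value l x = n}" for n
    using pos mem_first_column_ladder_iff[OF \<open>1 \<le> l\<close>] by auto
  have reading: "ladder_reading l S = concat (map (\<lambda>n. bottom_to_top {x \<in> S. ladder_value l x = n})
      (sorted_list_of_set (ladder_value l ` S)))"
    unfolding ladder_reading_def lad ..
  have set: "set (ladder_reading l S) = S"
    using fin by (auto simp: reading set_bottom_to_top)
  have "sorted_wrt (\<lambda>x y. fst y < fst x) (ladder_reading l S)"
    unfolding reading
  proof (rule sorted_wrt_concat_map[where Q = "(<)"])
    show "sorted_wrt (\<lambda>x y. fst y < fst x) (bottom_to_top {x \<in> S. ladder_value l x = n})" for n
      using fin inj by (intro sorted_wrt_bottom_to_top) (auto intro: inj_on_subset)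
    fix m n x y
    assume "m < n" "x \<in> set (bottom_to_top {x \<in> S. ladder_value l x = m})"
      "y \<in> set (bottom_to_top {x \<in> S. ladder_value l x = n})"
    then have x: "x \<in> S" and y: "y \<in> S" and less: "ladder_value l x < ladder_value l y"
      using fin by (simp_all add: set_bottom_to_top)
    \<comment> \<open>Boxes on different ladders lie in different rows by injectivity, and
      \<open>mono\<close> forbids the box of the earlier ladder to be the higher one.\<close>
    have "fst x \<noteq> fst y" using inj_onD[OF inj _ x y] less by auto
    moreover have "\<not> fst x < fst y" using mono[OF y x] less by auto
    ultimately show "fst y < fst x" by simp
  qed simp
  then show ?thesis
    using fin inj by (intro sorted_wrt_fst_unique sorted_wrt_bottom_to_top)
      (simp_all add: set set_bottom_to_top)
qed

theorem theorem3p8p2p1: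
  fixes l i :: nat and lam :: "nat list"
  assumes "l \<ge> 3" and "i < l" and "regular_partition l lam"
  shows "ladder_signature l i lam = i_signature l i lam \<and>
         reduced_word (ladder_signature l i lam) = reduced_i_signature l i lam"
proof -
  \<comment> \<open>The boxes themselves come in the same order, so the words and their reductions
    agree.\<close>
  have "ladder_reading l (signature_boxes l i lam) = bottom_to_top (signature_boxes l i lam)"
  proof (rule ladder_reading_eq_bottom_to_top)
    show "inj_on fst (signature_boxes l i lam)"
      using assms(1) by (intro inj_on_fst_signature_boxes) simp
    show "ladder_value l x \<le> ladder_value l y"
      if "x \<in> signature_boxes l i lam" "y \<in> signature_boxes l i lam" "fst y < fst x" for x y
      using that assms ladder_value_mono_signature_boxes[of l lam "fst x" "snd x" i "fst y" "snd y"]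
      by simp
  qed (use assms(1) in \<open>auto simp: finite_signature_boxes dest: signature_box_pos\<close>)
  then show ?thesis
    by (simp add: ladder_signature_def i_signature_def reduced_i_signature_def)
qed

end
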